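(* Assume that the following assertion (the conjecture of Jaeger, Linial, Payan and Tarsi) is true: for every $5$-edge-connected graph $H$ and every mapping $q:V(H)\rightarrow \mathbb{Z}_3$ with $|E(H)|\equiv \sum_{v\in V(H)}q(v) \pmod 3$, the graph $H$ admits a $q$-orientation. Let $G$ be a graph and let $p:V(G)\rightarrow \mathbb{Z}_3$ be a mapping such that $|E(G)|\equiv\sum_{v\in V(G)}p(v) \pmod 3$. If $G$ is $3$-tree-connected, then $G$ admits a $p$-orientation.
   Context: All graphs are finite and have no loops, but multiple edges are allowed. $\mathbb{Z}_3$ denotes the cyclic group of order $3$. For a graph $G$ and a mapping $p:V(G)\rightarrow \mathbb{Z}_3$ with $|E(G)|\equiv\sum_{v\in V(G)}p(v)\pmod 3$, a $p$-orientation of $G$ is an orientation of the edges of $G$ such that $d_G^+(v)\equiv p(v)\pmod 3$ for every vertex $v$, where $d_G^+(v)$ denotes the out-degree of $v$. A graph is called $k$-tree-connected if it contains $k$ pairwise edge-disjoint spanning trees. *)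

theory Defs
  imports "Graph_Theory.Digraph" "HOL-Library.Numeral_Type" "HOL-Library.Disjoint_Sets"
    "HOL-Number_Theory.Cong"
begin

text \<open>
  Finite loopless undirected graphs with named edges: parallel edges are distinct edges with
  the same set of endpoints, and loops are excluded because every edge has exactly two endpoints.
\<close>

record ('v, 'e) ugraph =
  uverts :: "'v set"
  uedges :: "'e set"
  ends :: "'e \<Rightarrow> 'v set"

locale fin_multigraph =
  fixes G :: "('v, 'e) ugraph"
  assumes finite_uverts: "finite (uverts G)"
    and finite_uedges: "finite (uedges G)"
    and ends_subset: "e \<in> uedges G \<Longrightarrow> ends G e \<subseteq> uverts G"
    and card_ends: "e \<in> uedges G \<Longrightarrow> card (ends G e) = 2"

definition adj_rel :: "('v, 'e) ugraph \<Rightarrow> 'v rel" where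
  "adj_rel G = {(u, v). \<exists>e \<in> uedges G. ends G e = {u, v}}"

definition ugraph_connected :: "('v, 'e) ugraph \<Rightarrow> bool" where
  "ugraph_connected G \<longleftrightarrow>
     uverts G \<noteq> {} \<and> (\<forall>u \<in> uverts G. \<forall>v \<in> uverts G. (u, v) \<in> (adj_rel G)\<^sup>*)"

definition restrict_edges :: "('v, 'e) ugraph \<Rightarrow> 'e set \<Rightarrow> ('v, 'e) ugraph" where
  "restrict_edges G T = G\<lparr>uedges := T\<rparr>"

text \<open>The one-vertex graph counts as \<open>k\<close>-edge-connected for every \<open>k\<close>.\<close>

definition edge_connected :: "nat \<Rightarrow> ('v, 'e) ugraph \<Rightarrow> bool" where
  "edge_connected k G \<longleftrightarrow>
     (\<forall>F \<subseteq> uedges G. card F < k \<longrightarrow> ugraph_connected (restrict_edges G (uedges G - F)))"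

text \<open>
  The edge \<open>es ! i\<close> joins \<open>vs ! i\<close> to its cyclic successor. Length 2 is allowed, since two
  parallel edges form a cycle.
\<close>

definition is_cycle :: "('v, 'e) ugraph \<Rightarrow> 'v list \<Rightarrow> 'e list \<Rightarrow> bool" where
  "is_cycle G vs es \<longleftrightarrow>
     2 \<le> length vs \<and> length es = length vs \<and> distinct vs \<and> distinct es \<and>
     set vs \<subseteq> uverts G \<and> set es \<subseteq> uedges G \<and>
     (\<forall>i < length vs. ends G (es ! i) = {vs ! i, vs ! (Suc i mod length vs)})"

definition is_tree :: "('v, 'e) ugraph \<Rightarrow> bool" where
  "is_tree G \<longleftrightarrow> ugraph_connected G \<and> (\<nexists>vs es. is_cycle G vs es)"

definition is_spanning_tree :: "('v, 'e) ugraph \<Rightarrow> 'e set \<Rightarrow> bool" where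
  "is_spanning_tree G T \<longleftrightarrow> T \<subseteq> uedges G \<and> is_tree (restrict_edges G T)"

text \<open>
  An indexed family, not a set, of trees: on a single vertex the (edgeless) spanning tree is
  edge-disjoint from itself.
\<close>

definition tree_connected :: "nat \<Rightarrow> ('v, 'e) ugraph \<Rightarrow> bool" where
  "tree_connected k G \<longleftrightarrow>
     (\<exists>T :: nat \<Rightarrow> 'e set. (\<forall>i < k. is_spanning_tree G (T i)) \<and> disjoint_family_on T {..<k})"

definition is_orientation :: "('v, 'e) ugraph \<Rightarrow> ('v, 'e) pre_digraph \<Rightarrow> bool" where
  "is_orientation G D \<longleftrightarrow>
     verts D = uverts G \<and> arcs D = uedges G \<and>
     (\<forall>e \<in> uedges G. {tail D e, head D e} = ends G e)"

text \<open>
  The cyclic group of order 3 is the numeral type \<open>3\<close>, the integers modulo 3, so congruence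
  modulo 3 becomes equality in that type:
\<close>

lemma of_nat_Z3_eq_iff: "(of_nat a :: 3) = of_nat b \<longleftrightarrow> [a = b] (mod 3)"
  by (simp add: of_nat_eq_iff_cong_CHAR)

definition p_balanced :: "('v, 'e) ugraph \<Rightarrow> ('v \<Rightarrow> 3) \<Rightarrow> bool" where
  "p_balanced G p \<longleftrightarrow> of_nat (card (uedges G)) = (\<Sum>v \<in> uverts G. p v)"

definition is_p_orientation ::
    "('v, 'e) ugraph \<Rightarrow> ('v \<Rightarrow> 3) \<Rightarrow> ('v, 'e) pre_digraph \<Rightarrow> bool" where
  "is_p_orientation G p D \<longleftrightarrow>
     is_orientation G D \<and> (\<forall>v \<in> uverts G. of_nat (out_degree D v) = p v)"

text \<open>
  The conjecture of Jaeger, Linial, Payan and Tarsi. Since a proposition cannot quantify over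
  types, it ranges over graphs with vertices and edges named by natural numbers; every finite
  graph is isomorphic to such a graph.
\<close>

definition JLPT_conjecture :: bool where
  "JLPT_conjecture \<longleftrightarrow>
     (\<forall>(H :: (nat, nat) ugraph) q.
        fin_multigraph H \<longrightarrow> edge_connected 5 H \<longrightarrow> p_balanced H q \<longrightarrow>
        (\<exists>D. is_p_orientation H q D))"

end

theory Submission
  imports Defs
begin

text \<open>
  Induction on the number of vertices, for three disjoint edge sets \<open>T i\<close> each of which meets every
  edge cut (minimality of the trees is irrelevant). If all cuts have at least five edges, the
  conjecture applies. Otherwise some cut has at most four edges, so at most one \<open>T j\<close> uses two of
  them and the others use one, and then all three sets span one of its two sides, \<open>X\<close>. If \<open>X\<close> has
  two or more vertices, orient the contraction of \<open>X\<close> and then the inside of \<open>X\<close> with a corrected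
  demand. If \<open>X = {x}\<close>, either the sets still span the graph without \<open>x\<close>, and the edges at \<open>x\<close> are
  oriented directly, or \<open>x\<close> has degree four and two edges of \<open>T j\<close> at \<open>x\<close> are split off: they
  become one edge between the neighbours, which keeps \<open>T j\<close> spanning.
\<close>

section \<open>Cuts, spanning edge sets, induced subgraphs and contractions\<close>

definition edge_cut :: "('v, 'e) ugraph \<Rightarrow> 'v set \<Rightarrow> 'e set" where
  "edge_cut G S = {e \<in> uedges G. ends G e \<inter> S \<noteq> {} \<and> \<not> ends G e \<subseteq> S}"

text \<open>On a nonempty vertex set this is connectedness using only edges of \<open>T\<close>,
  phrased by cuts so that no paths need to be rerouted. \<open>T\<close> need not lie in
  \<open>uedges G\<close>, so the same set can be used in graphs obtained by deleting edges.\<close>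

definition spans :: "('v, 'e) ugraph \<Rightarrow> 'e set \<Rightarrow> bool" where
  "spans G T \<longleftrightarrow> (\<forall>S. S \<subset> uverts G \<longrightarrow> S \<noteq> {} \<longrightarrow> edge_cut G S \<inter> T \<noteq> {})"

definition induced :: "('v, 'e) ugraph \<Rightarrow> 'v set \<Rightarrow> ('v, 'e) ugraph" where
  "induced G X = \<lparr>uverts = X, uedges = {e \<in> uedges G. ends G e \<subseteq> X}, ends = ends G\<rparr>"

text \<open>The merged vertex is named by a representative \<open>x\<close> of \<open>X\<close>.
  Edges keep their names, and those inside \<open>X\<close>, which would become loops, are
  dropped.\<close>

definition contract :: "('v, 'e) ugraph \<Rightarrow> 'v set \<Rightarrow> 'v \<Rightarrow> ('v, 'e) ugraph" where
  "contract G X x =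
     \<lparr>uverts = insert x (uverts G - X), uedges = {e \<in> uedges G. \<not> ends G e \<subseteq> X},
      ends = (\<lambda>e. (\<lambda>v. if v \<in> X then x else v) ` ends G e)\<rparr>"

text \<open>The function \<open>t\<close> below chooses the tail of each edge.\<close>

definition orientable :: "('v, 'e) ugraph \<Rightarrow> ('v \<Rightarrow> 3) \<Rightarrow> bool" where
  "orientable G p \<longleftrightarrow>
     (\<exists>t. (\<forall>e \<in> uedges G. t e \<in> ends G e) \<and>
          (\<forall>v \<in> uverts G. of_nat (card {e \<in> uedges G. t e = v}) = p v))"

text \<open>Out-degrees depend on tails alone, and the head of an edge is recovered as its other
  end.\<close>

lemma orientable_iff_p_orientation:
  assumes "fin_multigraph G"
  shows "orientable G p \<longleftrightarrow> (\<exists>D. is_p_orientation G p D)"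
proof
  assume "orientable G p"
  then obtain t where t: "\<forall>e \<in> uedges G. t e \<in> ends G e"
    "\<forall>v \<in> uverts G. of_nat (card {e \<in> uedges G. t e = v}) = p v"
    unfolding orientable_def by blast
  have "\<exists>h. {t e, h} = ends G e" if "e \<in> uedges G" for e
  proof -
    from fin_multigraph.card_ends[OF assms that] obtain a b where "ends G e = {a, b}"
      unfolding card_2_iff by blast
    moreover from this have "t e = a \<or> t e = b" using t(1) that by auto
    ultimately show ?thesis by (metis insert_commute)
  qed
  then obtain h where h: "\<forall>e \<in> uedges G. {t e, h e} = ends G e" by metis
  define D where "D = \<lparr>verts = uverts G, arcs = uedges G, tail = t, head = h\<rparr>"
  have "is_p_orientation G p D"
    using h t(2) by (simp add: is_p_orientation_def is_orientation_def D_def out_degree_def out_arcs_def)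
  then show "\<exists>D. is_p_orientation G p D" ..
next
  assume "\<exists>D. is_p_orientation G p D"
  then obtain D where "is_p_orientation G p D" ..
  then show "orientable G p"
    unfolding orientable_def is_p_orientation_def is_orientation_def out_degree_def out_arcs_def
    by (intro exI[of _ "tail D"]) auto
qed

lemma ends_pair:
  assumes "fin_multigraph G" "e \<in> uedges G"
  obtains a b where "ends G e = {a, b}" "a \<noteq> b" "a \<in> uverts G" "b \<in> uverts G"
proof -
  obtain a b where "ends G e = {a, b}" "a \<noteq> b"
    using fin_multigraph.card_ends[OF assms] unfolding card_2_iff by blast
  with fin_multigraph.ends_subset[OF assms] that show thesis by simp
qed

lemma edge_cut_subset: "edge_cut G S \<subseteq> uedges G"
  by (auto simp: edge_cut_def)

lemma finite_edge_cut: "fin_multigraph G \<Longrightarrow> finite (edge_cut G S)"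
  using edge_cut_subset fin_multigraph.finite_uedges finite_subset by metis

lemma edge_cut_complement:
  assumes "fin_multigraph G"
  shows "edge_cut G (uverts G - S) = edge_cut G S"
proof -
  have "ends G e \<inter> (uverts G - S) \<noteq> {} \<longleftrightarrow> \<not> ends G e \<subseteq> S"
    "\<not> ends G e \<subseteq> uverts G - S \<longleftrightarrow> ends G e \<inter> S \<noteq> {}" if "e \<in> uedges G" for e
    using fin_multigraph.ends_subset[OF assms that] by blast+
  then show ?thesis unfolding edge_cut_def by blast
qed

lemma uedges_diff_induced:
  assumes "fin_multigraph G"
  shows "uedges G - uedges (induced G X) = edge_cut G X \<union> uedges (induced G (uverts G - X))"
proof -
  have "e \<in> edge_cut G X \<or> ends G e \<subseteq> uverts G - X" if "e \<in> uedges G" "\<not> ends G e \<subseteq> X" for e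
    using fin_multigraph.ends_subset[OF assms that(1)] that by (auto simp: edge_cut_def)
  moreover have "\<not> ends G e \<subseteq> X" if "e \<in> uedges G" "ends G e \<subseteq> uverts G - X" for e
    using fin_multigraph.card_ends[OF assms that(1)] that(2) by (auto simp: disjoint_iff subset_iff)
  ultimately show ?thesis unfolding edge_cut_def induced_def by auto
qed

lemma fin_multigraph_induced:
  assumes "fin_multigraph G" "X \<subseteq> uverts G"
  shows "fin_multigraph (induced G X)"
  using assms unfolding fin_multigraph_def induced_def by (auto intro: finite_subset)

lemma fin_multigraph_contract:
  assumes "fin_multigraph G" "x \<in> X"
  shows "fin_multigraph (contract G X x)"
proof
  fix e assume "e \<in> uedges (contract G X x)"
  then have e: "e \<in> uedges G" "\<not> ends G e \<subseteq> X" by (auto simp: contract_def)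
  with ends_pair[OF assms(1)] obtain a b where ab: "ends G e = {a, b}" "a \<noteq> b"
    "a \<in> uverts G" "b \<in> uverts G" by metis
  show "ends (contract G X x) e \<subseteq> uverts (contract G X x)"
    using ab by (auto simp: contract_def)
  show "card (ends (contract G X x) e) = 2"
    using ab(1,2) e assms(2) by (cases "a \<in> X"; cases "b \<in> X") (auto simp: contract_def card_insert_if)
qed (use assms in \<open>simp_all add: contract_def fin_multigraph_def\<close>)

text \<open>A cut of the contraction pulls back along the quotient map to a cut of \<open>G\<close>.
  A crossing edge there is not inside \<open>X\<close>, because \<open>X\<close> is sent to a single
  vertex.\<close>

lemma spans_contract:
  assumes G: "fin_multigraph G" and "spans G T" "x \<in> X" "X \<subseteq> uverts G"
  shows "spans (contract G X x) T"
  unfolding spans_def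
proof (intro allI impI)
  fix S assume S: "S \<subset> uverts (contract G X x)" "S \<noteq> {}"
  define f where "f = (\<lambda>v. if v \<in> X then x else v)"
  define S' where "S' = {v \<in> uverts G. f v \<in> S}"
  have "S' \<subset> uverts G" "S' \<noteq> {}"
    using S assms(3,4) by (auto simp: S'_def f_def contract_def split: if_splits)
  then obtain e where e: "e \<in> edge_cut G S'" "e \<in> T"
    using assms(2) unfolding spans_def by blast
  then have eG: "e \<in> uedges G" "ends G e \<subseteq> uverts G"
    using fin_multigraph.ends_subset[OF G] by (auto simp: edge_cut_def)
  have "f ` ends G e \<inter> S \<noteq> {}" "\<not> f ` ends G e \<subseteq> S"
    using e(1) eG by (auto simp: edge_cut_def S'_def)
  moreover from this have "\<not> ends G e \<subseteq> X"
    by (auto simp: f_def)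
  ultimately have "e \<in> edge_cut (contract G X x) S"
    using eG by (simp add: edge_cut_def contract_def f_def)
  then show "edge_cut (contract G X x) S \<inter> T \<noteq> {}" using e(2) by blast
qed

section \<open>Spanning sets on the two sides of a small cut\<close>

text \<open>A common edge would need an end in \<open>S\<close>, one in \<open>X - S\<close> and one
  outside \<open>X\<close>, but it has only two ends.\<close>

lemma edge_cut_disjoint:
  assumes "fin_multigraph G" "S \<subseteq> X"
  shows "edge_cut G S \<inter> edge_cut G (X - S) \<inter> edge_cut G X = {}"
proof -
  have False if e: "e \<in> edge_cut G S" "e \<in> edge_cut G (X - S)" "e \<in> edge_cut G X" for e
  proof -
    have "e \<in> uedges G" using e by (auto simp: edge_cut_def)
    with ends_pair[OF assms(1)] obtain a b where "ends G e = {a, b}" by metis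
    then show False using e assms(2) by (auto simp: edge_cut_def)
  qed
  then show ?thesis by blast
qed

text \<open>If no edge of \<open>T\<close> joins \<open>S\<close> to \<open>X - S\<close>, then each
  of the two pieces is attached to the rest of \<open>G\<close> only by edges of \<open>T\<close>
  that leave \<open>X\<close>.\<close>

lemma not_spans_inducedE:
  assumes "fin_multigraph G" "spans G T" "X \<subset> uverts G" "\<not> spans (induced G X) T"
  obtains S where "S \<subset> X" "S \<noteq> {}"
    "edge_cut G S \<inter> T \<noteq> {}" "edge_cut G S \<inter> T \<subseteq> edge_cut G X"
    "edge_cut G (X - S) \<inter> T \<noteq> {}" "edge_cut G (X - S) \<inter> T \<subseteq> edge_cut G X"
proof -
  obtain S where S: "S \<subset> X" "S \<noteq> {}" "edge_cut (induced G X) S \<inter> T = {}"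
    using assms(4) by (auto simp: spans_def induced_def)
  have "S \<subset> uverts G" "X - S \<subset> uverts G" "X - S \<noteq> {}" using S(1) assms(3) by auto
  then have "edge_cut G S \<inter> T \<noteq> {}" "edge_cut G (X - S) \<inter> T \<noteq> {}"
    using S(2) assms(2) unfolding spans_def by simp_all
  moreover have "edge_cut G S \<inter> T \<subseteq> edge_cut G X" "edge_cut G (X - S) \<inter> T \<subseteq> edge_cut G X"
    using S by (fastforce simp: edge_cut_def induced_def)+
  ultimately show thesis using S that by blast
qed

text \<open>Each of the two pieces of \<open>X\<close> needs its own edge of \<open>T\<close>
  leaving \<open>X\<close>. Contrapositively, a spanning set with a single edge in the cut spans
  both sides.\<close>

lemma two_le_card_if_not_spans_induced:
  assumes "fin_multigraph G" "spans G T" "X \<subset> uverts G" "\<not> spans (induced G X) T"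
  shows "2 \<le> card (edge_cut G X \<inter> T)"
proof -
  obtain S where S: "S \<subset> X"
    "edge_cut G S \<inter> T \<noteq> {}" "edge_cut G S \<inter> T \<subseteq> edge_cut G X"
    "edge_cut G (X - S) \<inter> T \<noteq> {}" "edge_cut G (X - S) \<inter> T \<subseteq> edge_cut G X"
    using not_spans_inducedE[OF assms] by metis
  obtain f g where "f \<in> edge_cut G S \<inter> T" "g \<in> edge_cut G (X - S) \<inter> T" using S by blast
  moreover from this have "f \<noteq> g" using edge_cut_disjoint[OF assms(1), of S X] S by blast
  ultimately have "{f, g} \<subseteq> edge_cut G X \<inter> T" "card {f, g} = 2" using S by auto
  then show ?thesis using card_mono[of "edge_cut G X \<inter> T" "{f, g}"] finite_edge_cut[OF assms(1)] by simp
qed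

lemma not_spans_induced_pairE:
  assumes "fin_multigraph G" "spans G T" "X \<subset> uverts G" "\<not> spans (induced G X) T"
    and "card (edge_cut G X \<inter> T) \<le> 2"
  obtains S f g where "S \<subset> X" "S \<noteq> {}" "f \<noteq> g" "edge_cut G X \<inter> T = {f, g}"
    "edge_cut G S \<inter> T = {f}" "edge_cut G (X - S) \<inter> T = {g}"
proof -
  obtain S where S: "S \<subset> X" "S \<noteq> {}"
    "edge_cut G S \<inter> T \<noteq> {}" "edge_cut G S \<inter> T \<subseteq> edge_cut G X"
    "edge_cut G (X - S) \<inter> T \<noteq> {}" "edge_cut G (X - S) \<inter> T \<subseteq> edge_cut G X"
    using not_spans_inducedE[OF assms(1-4)] by metis
  obtain f g where fg: "f \<in> edge_cut G S \<inter> T" "g \<in> edge_cut G (X - S) \<inter> T" using S by blast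
  have ne: "f \<noteq> g" using edge_cut_disjoint[OF assms(1), of S X] S fg by blast
  have "{f, g} = edge_cut G X \<inter> T"
    using fg S ne assms(5) finite_edge_cut[OF assms(1), of X]
    by (intro card_seteq) auto
  moreover have "f \<notin> edge_cut G (X - S)" "g \<notin> edge_cut G S"
    using calculation fg S(1) edge_cut_disjoint[OF assms(1), of S X] by auto
  ultimately have "edge_cut G S \<inter> T = {f}" "edge_cut G (X - S) \<inter> T = {g}"
    using fg S(4,6) by auto
  then show thesis using that[of S f g] S(1,2) ne \<open>{f, g} = edge_cut G X \<inter> T\<close> by auto
qed

text \<open>If both sides fail, each falls into two pieces, each hanging on one of the two cut edges
  \<open>f\<close> and \<open>g\<close>. The two pieces joined by \<open>f\<close> then form a set
  that no edge of \<open>T\<close> leaves.\<close>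

lemma spans_induced_or_complement:
  assumes "fin_multigraph G" "spans G T" "X \<subset> uverts G" "X \<noteq> {}" "card (edge_cut G X \<inter> T) \<le> 2"
  shows "spans (induced G X) T \<or> spans (induced G (uverts G - X)) T"
proof (rule ccontr)
  let ?Y = "uverts G - X"
  assume neg: "\<not> ?thesis"
  obtain S f g where S: "S \<subset> X" "S \<noteq> {}" "f \<noteq> g" "edge_cut G X \<inter> T = {f, g}"
    "edge_cut G S \<inter> T = {f}" "edge_cut G (X - S) \<inter> T = {g}"
    using not_spans_induced_pairE[OF assms(1-3) _ assms(5)] neg by metis
  have Y: "?Y \<subset> uverts G" "card (edge_cut G ?Y \<inter> T) \<le> 2"
    using assms(3-5) edge_cut_complement[OF assms(1), of X] by auto
  obtain R f' g' where R: "R \<subset> ?Y" "R \<noteq> {}" "edge_cut G ?Y \<inter> T = {f', g'}"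
    "edge_cut G R \<inter> T = {f'}" "edge_cut G (?Y - R) \<inter> T = {g'}"
    using not_spans_induced_pairE[OF assms(1,2) Y(1) _ Y(2)] neg by metis
  have "{f', g'} = {f, g}" using R(3) S(4) edge_cut_complement[OF assms(1), of X] by simp
  \<comment> \<open>\<open>R'\<close> is whichever of the two pieces of the other side is attached
    by \<open>f\<close>.\<close>
  then obtain R' where R': "R' \<subset> ?Y" "R' \<noteq> {}" "edge_cut G R' \<inter> T = {f}"
  proof (cases "f = f'")
    case True
    then show thesis using R that by blast
  next
    case False
    then have "f = g'" using \<open>{f', g'} = {f, g}\<close> by blast
    then show thesis using R that[of "?Y - R"] by blast
  qed
  have "S \<union> R' \<subset> uverts G" "S \<union> R' \<noteq> {}" using S(1,2) R'(1) assms(3) by blast+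
  then obtain e where e: "e \<in> edge_cut G (S \<union> R')" "e \<in> T"
    using assms(2) unfolding spans_def by blast
  then have "e \<in> edge_cut G S \<or> e \<in> edge_cut G R'" by (auto simp: edge_cut_def)
  then have "e = f" using S R' e by blast
  \<comment> \<open>One end of \<open>f\<close> lies in \<open>S\<close> and the other in
    \<open>R'\<close>, so \<open>f\<close> lies inside the union and does not leave it.\<close>
  have "f \<in> edge_cut G S" "f \<in> edge_cut G R'" using S(5) R'(3) by auto
  moreover from this obtain a b where "ends G f = {a, b}"
    using ends_pair[OF assms(1)] by (metis (no_types, lifting) edge_cut_subset subsetD)
  ultimately show False
    using e(1) \<open>e = f\<close> S(1) R'(1) by (auto simp: edge_cut_def)
qed

section \<open>Counting tails and gluing orientations\<close>

lemma sum_card_tails: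
  assumes "finite F" "finite V" "\<forall>e \<in> F. t e \<in> V"
  shows "(\<Sum>v \<in> V. card {e \<in> F. t e = v}) = card F"
proof -
  have "card F = card (\<Union>v \<in> V. {e \<in> F. t e = v})"
    using assms(3) by (intro arg_cong[of _ _ card]) auto
  also have "\<dots> = (\<Sum>v \<in> V. card {e \<in> F. t e = v})"
    using assms by (intro card_UN_disjoint) auto
  finally show ?thesis by simp
qed

lemma card_tails_Un:
  assumes "finite A" "finite B" "A \<inter> B = {}"
  shows "card {e \<in> A \<union> B. t e = v} = card {e \<in> A. t e = v} + card {e \<in> B. t e = v}"
proof -
  have "{e \<in> A \<union> B. t e = v} = {e \<in> A. t e = v} \<union> {e \<in> B. t e = v}" by auto
  then show ?thesis using assms by (auto intro!: card_Un_disjoint)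
qed

text \<open>Once the edges not inside \<open>X\<close> have tails that satisfy every vertex outside
  \<open>X\<close>, the remaining demand \<open>q\<close> is met inside \<open>X\<close>.
  Orientability is assumed for every balanced demand because \<open>q\<close> depends on
  \<open>t\<close>.\<close>

lemma orientable_extend:
  fixes p :: "'v \<Rightarrow> 3"
  assumes G: "fin_multigraph G" "p_balanced G p" "X \<subseteq> uverts G"
    and t: "\<forall>e \<in> uedges G - uedges (induced G X). t e \<in> ends G e"
      "\<forall>v \<in> uverts G - X. of_nat (card {e \<in> uedges G - uedges (induced G X). t e = v}) = p v"
    and X: "\<And>q. p_balanced (induced G X) q \<Longrightarrow> orientable (induced G X) q"
  shows "orientable G p"
proof -
  interpret fin_multigraph G by fact
  let ?EX = "uedges (induced G X)"
  let ?F = "uedges G - ?EX"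
  have EX: "?EX \<subseteq> uedges G" by (auto simp: induced_def)
  define q where "q = (\<lambda>v. p v - of_nat (card {e \<in> ?F. t e = v}))"
  have finF: "finite ?F" using finite_uedges by simp
  have "(\<Sum>v \<in> uverts G. q v) = (\<Sum>v \<in> uverts G. p v) - of_nat (\<Sum>v \<in> uverts G. card {e \<in> ?F. t e = v})"
    by (simp add: q_def sum_subtractf)
  also have "(\<Sum>v \<in> uverts G. card {e \<in> ?F. t e = v}) = card ?F"
    using t(1) ends_subset by (intro sum_card_tails[OF finF finite_uverts]) auto
  also have "(\<Sum>v \<in> uverts G. p v) = of_nat (card (?EX \<union> ?F))"
    using G(2) EX by (simp add: p_balanced_def Un_absorb1)
  also have "card (?EX \<union> ?F) = card ?EX + card ?F"
    using finite_subset[OF EX finite_uedges] finF by (intro card_Un_disjoint) auto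
  finally have "(\<Sum>v \<in> uverts G. q v) = of_nat (card ?EX)" by simp
  \<comment> \<open>The remaining demand vanishes outside \<open>X\<close>, so the balance of
    \<open>G\<close> becomes the balance of the induced graph.\<close>
  moreover have "(\<Sum>v \<in> uverts G. q v) = (\<Sum>v \<in> X. q v)"
    using t(2) G(3) finite_uverts by (intro sum.mono_neutral_right) (auto simp: q_def)
  ultimately have "p_balanced (induced G X) q"
    by (simp add: p_balanced_def) (simp add: induced_def)
  then obtain s where s: "\<forall>e \<in> ?EX. s e \<in> ends G e"
      "\<forall>v \<in> X. of_nat (card {e \<in> ?EX. s e = v}) = q v"
    using X unfolding orientable_def by (fastforce simp: induced_def)
  define r where "r = (\<lambda>e. if e \<in> ?EX then s e else t e)"
  have split: "card {e \<in> uedges G. r e = v} = card {e \<in> ?EX. s e = v} + card {e \<in> ?F. t e = v}" for v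
  proof -
    have "card {e \<in> ?EX \<union> ?F. r e = v} = card {e \<in> ?EX. r e = v} + card {e \<in> ?F. r e = v}"
      using finite_subset[OF EX finite_uedges] finF by (intro card_tails_Un) auto
    moreover have "{e \<in> ?EX. r e = v} = {e \<in> ?EX. s e = v}" "{e \<in> ?F. r e = v} = {e \<in> ?F. t e = v}"
      by (auto simp: r_def)
    ultimately show ?thesis using EX by (simp add: Un_absorb1)
  qed
  have "of_nat (card {e \<in> uedges G. r e = v}) = p v" if v: "v \<in> uverts G" for v
  proof (cases "v \<in> X")
    case True
    then show ?thesis using s(2) by (simp add: split q_def)
  next
    case False
    then have no: "{e \<in> ?EX. s e = v} = {}" using s(1) by (auto simp: induced_def)
    show ?thesis using t(2) v False by (simp only: split no) simp
  qed
  moreover have "\<forall>e \<in> uedges G. r e \<in> ends G e" using s(1) t(1) by (simp add: r_def)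
  ultimately show ?thesis unfolding orientable_def by blast
qed

text \<open>An orientation of the contraction settles all edges not inside \<open>X\<close>
  correctly for the vertices outside \<open>X\<close>. The inside is then handled by
  \<open>orientable_extend\<close>.\<close>

lemma orientable_contract:
  fixes p :: "'v \<Rightarrow> 3"
  assumes G: "fin_multigraph G" "p_balanced G p" "X \<subseteq> uverts G" "x \<in> X"
    and C: "\<And>q. p_balanced (contract G X x) q \<Longrightarrow> orientable (contract G X x) q"
    and X: "\<And>q. p_balanced (induced G X) q \<Longrightarrow> orientable (induced G X) q"
  shows "orientable G p"
proof -
  interpret fin_multigraph G by fact
  let ?EX = "uedges (induced G X)"
  let ?F = "uedges G - ?EX"
  have EX: "?EX \<subseteq> uedges G" by (auto simp: induced_def)
  have F: "uedges (contract G X x) = ?F" by (auto simp: induced_def contract_def)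
  define f where "f = (\<lambda>v. if v \<in> X then x else v)"
  \<comment> \<open>The demand at the merged vertex is forced: the edges inside \<open>X\<close>
    will contribute exactly their number to the total out-degree of \<open>X\<close>.\<close>
  define q where "q = (\<lambda>v. if v = x then (\<Sum>v \<in> X. p v) - of_nat (card ?EX) else p v)"
  have "(\<Sum>v \<in> insert x (uverts G - X). q v) = q x + (\<Sum>v \<in> uverts G - X. q v)"
    using G(4) finite_uverts by (intro sum.insert) auto
  also have "(\<Sum>v \<in> uverts G - X. q v) = (\<Sum>v \<in> uverts G - X. p v)"
    using G(4) by (intro sum.cong) (auto simp: q_def)
  also have "q x + \<dots> = (\<Sum>v \<in> uverts G. p v) - of_nat (card ?EX)"
    using sum.subset_diff[OF G(3) finite_uverts, of p] by (simp add: q_def)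
  also have "(\<Sum>v \<in> uverts G. p v) = of_nat (card (?EX \<union> ?F))"
    using G(2) EX by (simp add: p_balanced_def Un_absorb1)
  also have "card (?EX \<union> ?F) = card ?EX + card ?F"
    using finite_subset[OF EX finite_uedges] finite_uedges by (intro card_Un_disjoint) auto
  finally have "p_balanced (contract G X x) q"
    unfolding p_balanced_def F by (simp add: contract_def)
  then have "orientable (contract G X x) q" by (rule C)
  then obtain s where s: "\<forall>e \<in> ?F. s e \<in> f ` ends G e"
    "\<forall>v \<in> insert x (uverts G - X). of_nat (card {e \<in> ?F. s e = v}) = q v"
    unfolding orientable_def F by (auto simp: contract_def f_def)
  \<comment> \<open>A tail at the merged vertex is lifted to an actual end in \<open>X\<close>;
    tails outside \<open>X\<close> stay the same.\<close>
  have "\<forall>e \<in> ?F. \<exists>u. u \<in> ends G e \<and> f u = s e" using s(1) by (metis imageE)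
  then obtain t where t: "\<forall>e \<in> ?F. t e \<in> ends G e \<and> f (t e) = s e" by metis
  have "of_nat (card {e \<in> ?F. t e = v}) = p v" if v: "v \<in> uverts G - X" for v
  proof -
    have "f u = v \<longleftrightarrow> u = v" for u using v G(4) by (auto simp: f_def)
    then have "t e = v \<longleftrightarrow> s e = v" if "e \<in> ?F" for e using t that by metis
    then have "{e \<in> ?F. t e = v} = {e \<in> ?F. s e = v}" by blast
    moreover have "q v = p v" using v G(4) by (auto simp: q_def)
    ultimately show ?thesis using s(2) v by simp
  qed
  then show ?thesis using t by (intro orientable_extend[OF G(1-3) _ _ X]) auto
qed

section \<open>Removing a vertex: deletion and splitting off\<close>

lemma Z3_eq_of_nat:
  fixes c :: 3
  obtains k where "k \<le> 2" "c = of_nat k"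
proof (cases c rule: bit1_cases)
  case (of_int z)
  then show thesis using that[of "nat z"] by simp
qed

text \<open>Subsets of sizes 0, 1 and 2 realise all residues, so two freely orientable edges at a
  vertex can meet any demand there.\<close>

lemma subset_card_Z3:
  fixes c :: 3
  assumes "2 \<le> card W"
  obtains U where "U \<subseteq> W" "of_nat (card U) = c"
proof -
  obtain k where k: "k \<le> 2" "c = of_nat k" by (rule Z3_eq_of_nat)
  then obtain U where "U \<subseteq> W" "card U = k"
    using obtain_subset_with_card_n[of k W] assms by auto
  then show thesis using that k by simp
qed

lemma edge_cut_at_vertex:
  assumes "fin_multigraph G" "x \<in> uverts G"
  shows "uedges G - uedges (induced G (uverts G - {x})) = edge_cut G {x}"
proof -
  have "uedges (induced G {x}) = {}"
    using fin_multigraph.card_ends[OF assms(1)] by (fastforce simp: induced_def subset_singleton_iff)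
  moreover have "uverts G - (uverts G - {x}) = {x}" using assms(2) by auto
  ultimately show ?thesis
    using uedges_diff_induced[OF assms(1), of "uverts G - {x}"] edge_cut_complement[OF assms(1), of "{x}"]
    by simp
qed

text \<open>The edges at \<open>x\<close> are oriented first, those in \<open>U\<close> away from
  \<open>x\<close>, which satisfies \<open>x\<close>. The other vertices are left to
  \<open>orientable_extend\<close>.\<close>

lemma orientable_delete_vertex:
  fixes p :: "'v \<Rightarrow> 3"
  assumes G: "fin_multigraph G" "p_balanced G p" "x \<in> uverts G"
    and deg: "2 \<le> card (edge_cut G {x})"
    and Y: "\<And>q. p_balanced (induced G (uverts G - {x})) q \<Longrightarrow> orientable (induced G (uverts G - {x})) q"
  shows "orientable G p"
proof -
  interpret fin_multigraph G by fact
  let ?Y = "uverts G - {x}"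
  have Y': "uverts G - ?Y = {x}" using G(3) by auto
  obtain U where U: "U \<subseteq> edge_cut G {x}" "of_nat (card U) = p x"
    using subset_card_Z3[OF deg] by metis
  have "\<exists>u. u \<in> ends G e \<and> (u = x \<longleftrightarrow> e \<in> U)" if "e \<in> edge_cut G {x}" for e
    using that by (cases "e \<in> U") (auto simp: edge_cut_def)
  then obtain t where t: "\<forall>e \<in> edge_cut G {x}. t e \<in> ends G e \<and> (t e = x \<longleftrightarrow> e \<in> U)" by metis
  then have "{e \<in> edge_cut G {x}. t e = x} = U" using U by auto
  then show ?thesis
    using t U Y'
    by (intro orientable_extend[OF G(1,2) _ _ _ Y, of t]) (auto simp: edge_cut_at_vertex[OF G(1,3)])
qed

text \<open>The lifted edge between \<open>a\<close> and \<open>b\<close> keeps the name \<open>e\<close>, so the sets \<open>T i\<close> need not change.\<close>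

definition split_off :: "('v, 'e) ugraph \<Rightarrow> 'v \<Rightarrow> 'e \<Rightarrow> 'v \<Rightarrow> 'v \<Rightarrow> ('v, 'e) ugraph" where
  "split_off G x e a b =
     \<lparr>uverts = uverts G - {x}, uedges = insert e (uedges (induced G (uverts G - {x}))),
      ends = (ends G)(e := {a, b})\<rparr>"

lemma fin_multigraph_split_off:
  assumes "fin_multigraph G" "a \<noteq> b" "{a, b} \<subseteq> uverts G - {x}"
  shows "fin_multigraph (split_off G x e a b)"
  using assms unfolding fin_multigraph_def split_off_def induced_def by auto

lemma spans_split_off_if_spans_induced:
  assumes "spans (induced G (uverts G - {x})) T" "x \<in> ends G e"
  shows "spans (split_off G x e a b) T"
  unfolding spans_def
proof (intro allI impI)
  fix S assume "S \<subset> uverts (split_off G x e a b)" "S \<noteq> {}"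
  then have "edge_cut (induced G (uverts G - {x})) S \<inter> T \<noteq> {}"
    using assms(1) by (auto simp: spans_def split_off_def induced_def)
  moreover have "edge_cut (induced G (uverts G - {x})) S \<subseteq> edge_cut (split_off G x e a b) S"
    using assms(2) by (auto simp: edge_cut_def split_off_def induced_def)
  ultimately show "edge_cut (split_off G x e a b) S \<inter> T \<noteq> {}" by blast
qed

text \<open>If \<open>S\<close> separates \<open>a\<close> from \<open>b\<close>, the lifted edge
  crosses. Otherwise the side of \<open>S\<close> avoiding both is left in \<open>G\<close> by an
  edge of \<open>T\<close> other than \<open>e\<close> and \<open>f\<close>; that edge is not
  incident with \<open>x\<close>, so it survives.\<close>

lemma spans_split_off:
  assumes "fin_multigraph G" "spans G T" "x \<in> uverts G" "edge_cut G {x} \<inter> T = {e, f}"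
    and "ends G e = {x, a}" "ends G f = {x, b}" "{a, b} \<subseteq> uverts G - {x}"
  shows "spans (split_off G x e a b) T"
  unfolding spans_def
proof (intro allI impI)
  let ?H = "split_off G x e a b"
  fix S assume S: "S \<subset> uverts ?H" "S \<noteq> {}"
  have eT: "e \<in> T" using assms(4) by blast
  show "edge_cut ?H S \<inter> T \<noteq> {}"
  proof (cases "a \<in> S \<longleftrightarrow> b \<in> S")
    case False
    then have "e \<in> edge_cut ?H S" by (auto simp: edge_cut_def split_off_def)
    then show ?thesis using eT by blast
  next
    case True
    \<comment> \<open>Complementary sets have the same cut, so the side containing neither
      \<open>a\<close> nor \<open>b\<close> may be used.\<close>
    obtain Z where Z: "Z \<subset> uverts ?H" "Z \<noteq> {}" "a \<notin> Z" "b \<notin> Z" "Z = S \<or> Z = uverts ?H - S"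
      using S True that[of S] that[of "uverts ?H - S"] by blast
    have "Z \<subset> uverts G" using Z(1) by (auto simp: split_off_def)
    then obtain g where g: "g \<in> edge_cut G Z" "g \<in> T"
      using Z(2) assms(2) unfolding spans_def by blast
    have "x \<notin> Z" using Z(1) by (auto simp: split_off_def)
    have "g \<noteq> e" "g \<noteq> f"
      using g(1) Z(3,4) \<open>x \<notin> Z\<close> assms(5,6) by (auto simp: edge_cut_def)
    then have "g \<notin> edge_cut G {x}" using assms(4) g(2) by blast
    then have "x \<notin> ends G g"
      using g(1) \<open>x \<notin> Z\<close> by (auto simp: edge_cut_def)
    moreover have "ends G g \<subseteq> uverts G" "g \<in> uedges G"
      using g(1) fin_multigraph.ends_subset[OF assms(1)] by (auto simp: edge_cut_def)
    ultimately have gH: "g \<in> uedges ?H" "ends ?H g = ends G g" "ends G g \<subseteq> uverts ?H"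
      using \<open>g \<noteq> e\<close> by (auto simp: split_off_def induced_def)
    then have "g \<in> edge_cut ?H S"
      using g(1) Z(5) S(1) by (auto simp: edge_cut_def)
    then show ?thesis using g(2) by blast
  qed
qed

text \<open>An oriented edge between \<open>a\<close> and \<open>b\<close> is subdivided into a
  directed path through \<open>x\<close>, which preserves the out-degrees of \<open>a\<close> and
  \<open>b\<close>. At least two other edges at \<open>x\<close> remain for adjusting its
  out-degree.\<close>

lemma orientable_split_off:
  fixes p :: "'v \<Rightarrow> 3"
  assumes G: "fin_multigraph G" "p_balanced G p" "x \<in> uverts G"
    and ef: "e \<in> edge_cut G {x}" "f \<in> edge_cut G {x}" "e \<noteq> f"
      "ends G e = {x, a}" "ends G f = {x, b}" "x \<noteq> a" "x \<noteq> b" "a \<noteq> b"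
    and deg: "4 \<le> card (edge_cut G {x})"
    and H: "\<And>q. p_balanced (split_off G x e a b) q \<Longrightarrow> orientable (split_off G x e a b) q"
  shows "orientable G p"
proof -
  interpret fin_multigraph G by fact
  let ?Y = "uverts G - {x}"
  let ?EY = "uedges (induced G ?Y)"
  define W where "W = edge_cut G {x} - {e, f}"
  have fin: "finite W" "finite ?EY"
    using finite_edge_cut[OF G(1)] finite_uedges by (auto simp: W_def induced_def)
  have disj: "?EY \<inter> W = {}" "(?EY \<union> W) \<inter> {e, f} = {}"
    using ef by (auto simp: W_def induced_def edge_cut_def)
  have E: "uedges G = ?EY \<union> W \<union> {e, f}"
    using ef edge_cut_at_vertex[OF G(1,3)] by (auto simp: W_def induced_def)
  have "2 \<le> card W" using deg ef by (simp add: W_def card_Diff_subset)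
  \<comment> \<open>The lifted path enters \<open>x\<close> once and leaves it once, hence the \<open>- 1\<close>.\<close>
  then obtain U where U: "U \<subseteq> W" "of_nat (card U) = p x - 1"
    using subset_card_Z3 by metis
  have "\<exists>u. u \<in> ends G g \<and> (u = x \<longleftrightarrow> g \<in> U)" if "g \<in> W" for g
    using that by (cases "g \<in> U") (auto simp: W_def edge_cut_def)
  then obtain t where t: "\<forall>g \<in> W. t g \<in> ends G g \<and> (t g = x \<longleftrightarrow> g \<in> U)" by metis
  then have tx: "{g \<in> W. t g = x} = U" using U by auto
  define q where "q = (\<lambda>v. p v - of_nat (card {g \<in> W. t g = v}))"
  have "(\<Sum>v \<in> ?Y. q v) = (\<Sum>v \<in> uverts G. q v) - q x"
    using finite_uverts G(3) by (simp add: sum_diff1)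
  also have "(\<Sum>v \<in> uverts G. q v)
      = (\<Sum>v \<in> uverts G. p v) - of_nat (\<Sum>v \<in> uverts G. card {g \<in> W. t g = v})"
    by (simp add: q_def sum_subtractf)
  also have "(\<Sum>v \<in> uverts G. card {g \<in> W. t g = v}) = card W"
    using t ends_subset E by (intro sum_card_tails fin finite_uverts) blast
  also have "(\<Sum>v \<in> uverts G. p v) = of_nat (card (?EY \<union> W \<union> {e, f}))"
    using G(2) E by (simp add: p_balanced_def)
  also have "card (?EY \<union> W \<union> {e, f}) = card ?EY + card W + 2"
    using fin disj ef(3) by (simp add: card_Un_disjoint)
  \<comment> \<open>Here \<open>q x = 1\<close>, so of the two edges \<open>e\<close> and
    \<open>f\<close> just one is left to count, the lifted edge.\<close>
  finally have "(\<Sum>v \<in> ?Y. q v) = of_nat (card ?EY + 1)"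
    using U(2) tx by (simp add: q_def)
  moreover have "card (insert e ?EY) = card ?EY + 1" using fin disj by simp
  ultimately have "p_balanced (split_off G x e a b) q"
    by (simp add: p_balanced_def split_off_def)
  then have "orientable (split_off G x e a b) q" by (rule H)
  then obtain s where s: "\<forall>g \<in> insert e ?EY. s g \<in> ((ends G)(e := {a, b})) g"
    "\<forall>v \<in> ?Y. of_nat (card {g \<in> insert e ?EY. s g = v}) = q v"
    unfolding orientable_def by (auto simp: split_off_def)
  have se: "s e = a \<or> s e = b" using s(1) by simp
  have sY: "\<forall>g \<in> ?EY. s g \<in> ends G g" using s(1) disj(2) by (metis Int_iff Un_iff empty_iff fun_upd_apply insert_iff)
  \<comment> \<open>The path runs from \<open>a\<close> through \<open>x\<close> to \<open>b\<close>
    if the lifted edge has tail \<open>a\<close>, and from \<open>b\<close> through \<open>x\<close>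
    to \<open>a\<close> otherwise.\<close>
  define r where "r = (\<lambda>g. if g \<in> W then t g else if g = e then (if s e = a then a else x)
      else if g = f then (if s e = a then x else b) else s g)"
  have r: "\<forall>g \<in> uedges G. r g \<in> ends G g"
    using sY t ef(4,5) by (auto simp: r_def E)
  have split: "card {g \<in> uedges G. r g = v}
      = card {g \<in> ?EY. s g = v} + card {g \<in> W. t g = v} + card {g \<in> {e, f}. r g = v}" for v
  proof -
    have "card {g \<in> ?EY \<union> W \<union> {e, f}. r g = v}
        = card {g \<in> ?EY. r g = v} + card {g \<in> W. r g = v} + card {g \<in> {e, f}. r g = v}"
      using card_tails_Un[of "?EY \<union> W" "{e, f}" r v] card_tails_Un[of ?EY W r v] fin disj by simp
    moreover have "{g \<in> ?EY. r g = v} = {g \<in> ?EY. s g = v}" "{g \<in> W. r g = v} = {g \<in> W. t g = v}"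
      using disj by (auto simp: r_def)
    ultimately show ?thesis using E by simp
  qed
  have nW: "e \<notin> W" "f \<notin> W" by (auto simp: W_def)
  have "of_nat (card {g \<in> uedges G. r g = v}) = p v" if v: "v \<in> uverts G" for v
  proof (cases "v = x")
    case True
    have "{g \<in> ?EY. s g = x} = {}" using sY by (auto simp: induced_def)
    moreover have "{g \<in> {e, f}. r g = x} = {if s e = a then f else e}"
      using ef nW by (auto simp: r_def)
    ultimately show ?thesis using True U(2) tx by (simp only: split) simp
  next
    case False
    \<comment> \<open>Away from \<open>x\<close>, the pair \<open>e\<close>, \<open>f\<close>
      contributes exactly what the lifted edge contributes.\<close>
    have "{g \<in> {e, f}. r g = v}
        = (if s e = v then {if s e = a then e else f} else {})"
      using ef nW se False by (auto simp: r_def)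
    moreover have "{g \<in> {e}. s g = v} = (if s e = v then {e} else {})" by auto
    ultimately have "card {g \<in> {e, f}. r g = v} = card {g \<in> {e}. s g = v}" by simp
    moreover have "card {g \<in> ?EY \<union> {e}. s g = v} = card {g \<in> ?EY. s g = v} + card {g \<in> {e}. s g = v}"
      using fin disj by (intro card_tails_Un) auto
    ultimately have "card {g \<in> uedges G. r g = v}
        = card {g \<in> insert e ?EY. s g = v} + card {g \<in> W. t g = v}"
      by (simp only: split) simp
    then show ?thesis using s(2) v False by (simp add: q_def)
  qed
  then show ?thesis using r unfolding orientable_def by blast
qed

section \<open>Connectivity by cuts and transfer of the conjecture\<close>

text \<open>A walk starting in \<open>S\<close> can leave it only through an edge of
  \<open>T\<close> in the cut.\<close>

lemma ugraph_connected_imp_spans: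
  assumes "ugraph_connected (restrict_edges G T)" "T \<subseteq> uedges G"
  shows "spans G T"
  unfolding spans_def
proof (intro allI impI)
  fix S assume S: "S \<subset> uverts G" "S \<noteq> {}"
  then obtain u v where uv: "u \<in> S" "v \<in> uverts G" "v \<notin> S" by blast
  then have "(u, v) \<in> (adj_rel (restrict_edges G T))\<^sup>*"
    using assms(1) S by (auto simp: ugraph_connected_def restrict_edges_def)
  then have "v \<in> S \<or> edge_cut G S \<inter> T \<noteq> {}"
  proof induction
    case base
    then show ?case using uv by simp
  next
    case (step y z)
    then show ?case
      using assms(2) by (fastforce simp: adj_rel_def restrict_edges_def edge_cut_def)
  qed
  then show "edge_cut G S \<inter> T \<noteq> {}" using uv by simp
qed

text \<open>If deleting \<open>F\<close> disconnects \<open>u\<close> from \<open>v\<close>, the cut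
  around the set reachable from \<open>u\<close> lies in \<open>F\<close> and is too small.\<close>

lemma edge_connected_if_edge_cuts:
  assumes "fin_multigraph G" "uverts G \<noteq> {}"
    and "\<And>S. S \<subset> uverts G \<Longrightarrow> S \<noteq> {} \<Longrightarrow> k \<le> card (edge_cut G S)"
  shows "edge_connected k G"
  unfolding edge_connected_def
proof (intro allI impI)
  fix F assume F: "F \<subseteq> uedges G" "card F < k"
  interpret fin_multigraph G by fact
  let ?H = "restrict_edges G (uedges G - F)"
  have "(u, v) \<in> (adj_rel ?H)\<^sup>*" if uv: "u \<in> uverts G" "v \<in> uverts G" for u v
  proof (rule ccontr)
    assume nr: "(u, v) \<notin> (adj_rel ?H)\<^sup>*"
    define S where "S = {w \<in> uverts G. (u, w) \<in> (adj_rel ?H)\<^sup>*}"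
    have "S \<subset> uverts G" "S \<noteq> {}" using uv nr by (auto simp: S_def)
    then have "k \<le> card (edge_cut G S)" by (rule assms(3))
    then have "\<not> edge_cut G S \<subseteq> F"
      using F card_mono finite_subset[OF F(1) finite_uedges] by (metis leD le_trans)
    then obtain e where e: "e \<in> edge_cut G S" "e \<notin> F" by blast
    then have "e \<in> uedges G" by (auto simp: edge_cut_def)
    with ends_pair[OF assms(1)] e(1) obtain a b
      where ab: "ends G e = {a, b}" "a \<in> S" "b \<notin> S" "b \<in> uverts G"
      by (smt (verit) Int_emptyI edge_cut_def insertE insert_commute mem_Collect_eq singletonD subsetI)
    then have "(a, b) \<in> adj_rel ?H"
      using e \<open>e \<in> uedges G\<close> by (auto simp: adj_rel_def restrict_edges_def)
    then have "b \<in> S" using ab by (auto simp: S_def intro: rtrancl.rtrancl_into_rtrancl)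
    then show False using ab by simp
  qed
  then show "ugraph_connected ?H"
    using assms(2) by (simp add: ugraph_connected_def restrict_edges_def)
qed

text \<open>The conjecture speaks of graphs on natural numbers, so \<open>G\<close> is copied along
  injections \<open>f\<close> and \<open>g\<close> and the resulting tails are carried back.\<close>

lemma orientable_if_edge_cuts_ge_5:
  fixes G :: "('v, 'e) ugraph"
  assumes "JLPT_conjecture" and G: "fin_multigraph G" "uverts G \<noteq> {}" "p_balanced G p"
    and cuts: "\<And>S. S \<subset> uverts G \<Longrightarrow> S \<noteq> {} \<Longrightarrow> 5 \<le> card (edge_cut G S)"
  shows "orientable G p"
proof -
  interpret fin_multigraph G by fact
  obtain f :: "'v \<Rightarrow> nat" where f: "inj_on f (uverts G)"
    using finite_imp_inj_to_nat_seg[OF finite_uverts] by blast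
  obtain g :: "'e \<Rightarrow> nat" where g: "inj_on g (uedges G)"
    using finite_imp_inj_to_nat_seg[OF finite_uedges] by blast
  define f' where "f' = inv_into (uverts G) f"
  define g' where "g' = inv_into (uedges G) g"
  define H where "H = \<lparr>uverts = f ` uverts G, uedges = g ` uedges G, ends = (\<lambda>n. f ` ends G (g' n))\<rparr>"
  have f': "f' (f v) = v" if "v \<in> uverts G" for v using f that by (simp add: f'_def)
  have g': "g' (g e) = e" if "e \<in> uedges G" for e using g that by (simp add: g'_def)
  have H: "uverts H = f ` uverts G" "uedges H = g ` uedges G"
    "\<And>e. e \<in> uedges G \<Longrightarrow> ends H (g e) = f ` ends G e"
    by (auto simp: H_def g')
  have "fin_multigraph H"
  proof
    fix n assume "n \<in> uedges H"
    then obtain e where e: "e \<in> uedges G" "n = g e" using H by auto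
    show "ends H n \<subseteq> uverts H" using e ends_subset by (auto simp: H)
    show "card (ends H n) = 2"
      using e ends_subset[OF e(1)] card_ends[OF e(1)] f by (simp add: H card_image inj_on_subset)
  qed (simp_all add: H finite_uverts finite_uedges)
  moreover have "edge_connected 5 H"
  proof (rule edge_connected_if_edge_cuts[OF \<open>fin_multigraph H\<close>])
    fix S assume S: "S \<subset> uverts H" "S \<noteq> {}"
    define S' where "S' = {v \<in> uverts G. f v \<in> S}"
    have "S' \<subset> uverts G" "S' \<noteq> {}" using S by (auto simp: H S'_def)
    then have "5 \<le> card (edge_cut G S')" by (rule cuts)
    also have "\<dots> = card (g ` edge_cut G S')"
      using g by (simp add: card_image inj_on_subset[OF g edge_cut_subset])
    also have "\<dots> \<le> card (edge_cut H S)"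
      using ends_subset by (intro card_mono finite_edge_cut \<open>fin_multigraph H\<close>)
        (fastforce simp: edge_cut_def H S'_def)
    finally show "5 \<le> card (edge_cut H S)" .
  qed (use G(2) H in simp)
  moreover have "p_balanced H (p \<circ> f')"
    using G(3) f g by (simp add: p_balanced_def H card_image sum.reindex f')
  ultimately have "orientable H (p \<circ> f')"
    using assms(1) orientable_iff_p_orientation unfolding JLPT_conjecture_def by metis
  then obtain s where s: "\<forall>e \<in> uedges G. s (g e) \<in> f ` ends G e"
    "\<forall>v \<in> uverts G. of_nat (card {n \<in> g ` uedges G. s n = f v}) = p v"
    unfolding orientable_def by (auto simp: H f')
  define t where "t = (\<lambda>e. f' (s (g e)))"
  have t: "t e \<in> ends G e \<and> f (t e) = s (g e)" if e: "e \<in> uedges G" for e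
  proof -
    obtain u where "u \<in> ends G e" "s (g e) = f u" using s(1) e by blast
    then show ?thesis using ends_subset[OF e] f' by (auto simp: t_def)
  qed
  have "of_nat (card {e \<in> uedges G. t e = v}) = p v" if v: "v \<in> uverts G" for v
  proof -
    have "t e = v \<longleftrightarrow> s (g e) = f v" if e: "e \<in> uedges G" for e
      using t[OF e] v f' by (auto simp: t_def)
    then have "{n \<in> g ` uedges G. s n = f v} = g ` {e \<in> uedges G. t e = v}" by auto
    moreover have "inj_on g {e \<in> uedges G. t e = v}" using g by (rule inj_on_subset) auto
    ultimately have "card {n \<in> g ` uedges G. s n = f v} = card {e \<in> uedges G. t e = v}"
      by (simp add: card_image)
    with bspec[OF s(2) v] show ?thesis by (simp only:)
  qed
  then show ?thesis using t unfolding orientable_def by blast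
qed

section \<open>The induction on the number of vertices\<close>

lemma sum_card_Int_le:
  assumes "finite A" "finite I" "disjoint_family_on T I"
  shows "(\<Sum>i \<in> I. card (A \<inter> T i)) \<le> card A"
proof -
  have "(\<Sum>i \<in> I. card (A \<inter> T i)) = card (\<Union>i \<in> I. A \<inter> T i)"
    using assms by (subst card_UN_disjoint) (auto simp: disjoint_family_on_def)
  also have "\<dots> \<le> card A" using assms(1) by (intro card_mono) auto
  finally show ?thesis .
qed

lemma orientable_if_three_disjoint_spanning:
  fixes G :: "('v, 'e) ugraph"
  assumes "JLPT_conjecture" "disjoint_family_on T {..<3::nat}"
    and "fin_multigraph G" "uverts G \<noteq> {}" "\<forall>i<3. spans G (T i)" "p_balanced G p"
  shows "orientable G p"
  using assms(3-)
\<comment> \<open>The family \<open>T\<close> stays fixed while \<open>G\<close> and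
  \<open>p\<close> vary, since every reduction keeps the edge names.\<close>
proof (induction "card (uverts G)" arbitrary: G p rule: less_induct)
  case less
  interpret fin_multigraph G by fact
  note G = less.prems(1)
  note IH = less.hyps
  show ?case
  proof (cases "\<exists>S. S \<subset> uverts G \<and> S \<noteq> {} \<and> card (edge_cut G S) \<le> 4")
    case False
    have "5 \<le> card (edge_cut G S)" if "S \<subset> uverts G" "S \<noteq> {}" for S
    proof -
      have "\<not> card (edge_cut G S) \<le> 4" using False that by blast
      then show ?thesis by linarith
    qed
    then show ?thesis
      using orientable_if_edge_cuts_ge_5 assms(1) less.prems by blast
  next
    case True
    then obtain S where S: "S \<subset> uverts G" "S \<noteq> {}" "card (edge_cut G S) \<le> 4" by blast
    let ?c = "\<lambda>i. card (edge_cut G S \<inter> T i)"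
    have pos: "1 \<le> ?c i" if "i < 3" for i
    proof -
      have "edge_cut G S \<inter> T i \<noteq> {}" using less.prems(3) that S unfolding spans_def by blast
      then show ?thesis using finite_edge_cut[OF G] by (simp add: Suc_le_eq card_gt_0_iff)
    qed
    have sum: "?c 0 + ?c 1 + ?c 2 \<le> card (edge_cut G S)"
      using sum_card_Int_le[OF finite_edge_cut[OF G] _ assms(2), of S]
      by (simp add: numeral_3_eq_3 numeral_2_eq_2)
    have lt3: "i < 3 \<longleftrightarrow> i = 0 \<or> i = 1 \<or> i = 2" for i :: nat by auto
    \<comment> \<open>Three positive integers with sum at most 4 are all 1, except possibly a single
      2.\<close>
    obtain j where j: "j < 3" "?c j \<le> 2" "\<And>i. i < 3 \<Longrightarrow> i \<noteq> j \<Longrightarrow> ?c i = 1"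
    proof -
      consider "?c 0 \<le> 2" "?c 1 = 1" "?c 2 = 1" | "?c 1 \<le> 2" "?c 0 = 1" "?c 2 = 1"
          | "?c 2 \<le> 2" "?c 0 = 1" "?c 1 = 1"
        using sum S(3) pos[of 0] pos[of 1] pos[of 2] by (simp del: One_nat_def) arith
      then show thesis
      proof cases
        case 1
        then show thesis by (intro that[of 0]) (auto simp only: lt3)
      next
        case 2
        then show thesis by (intro that[of 1]) (auto simp only: lt3)
      next
        case 3
        then show thesis by (intro that[of 2]) (auto simp only: lt3)
      qed
    qed
    have le2: "?c i \<le> 2" if "i < 3" for i using j that by (cases "i = j") auto
    \<comment> \<open>A set other than \<open>T j\<close> has one edge in the cut, too few to fail
      on either side.\<close>
    have side: "spans (induced G X) (T i)"
      if "i < 3" "i \<noteq> j" "X = S \<or> X = uverts G - S" for i X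
    proof (rule ccontr)
      assume "\<not> ?thesis"
      moreover have "X \<subset> uverts G" "edge_cut G X = edge_cut G S"
        using that(3) S edge_cut_complement[OF G] by auto
      ultimately show False
        using two_le_card_if_not_spans_induced[OF G, of "T i" X] less.prems(3) that j(3)[of i] by simp
    qed
    obtain X where X: "X = S \<or> X = uverts G - S" "spans (induced G X) (T j)"
      using spans_induced_or_complement[OF G, of "T j" S] S less.prems(3) j by blast
    have XV: "X \<subset> uverts G" "X \<noteq> {}" "edge_cut G X = edge_cut G S"
      using X(1) S edge_cut_complement[OF G] by auto
    have spX: "\<forall>i<3. spans (induced G X) (T i)" using side X by metis
    have finX: "finite X" using XV(1) finite_uverts by (auto intro: finite_subset)
    obtain x where x: "x \<in> X" using XV(2) by blast
    show ?thesis
    proof (cases "X = {x}")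
      case False
      then have card: "2 \<le> card X"
        using x finX by (metis card_1_singletonE card_gt_0_iff empty_iff less_2_cases not_le singletonD not_gr_zero One_nat_def)
      have "uverts (contract G X x) = insert x (uverts G - X)" by (simp add: contract_def)
      moreover have "card (insert x (uverts G - X)) = Suc (card (uverts G) - card X)"
        using x XV(1) finX finite_uverts by (simp add: card_Diff_subset)
      moreover have "card X \<le> card (uverts G)" using XV(1) finite_uverts by (auto intro: card_mono)
      ultimately have "card (uverts (contract G X x)) < card (uverts G)" using card by simp
      moreover have "\<forall>i<3. spans (contract G X x) (T i)"
        using spans_contract[OF G _ x] less.prems(3) XV(1) by blast
      moreover have "card (uverts (induced G X)) < card (uverts G)"
        using XV(1) finite_uverts by (simp add: induced_def psubset_card_mono)
      ultimately show ?thesis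
        using XV x spX fin_multigraph_contract[OF G x] fin_multigraph_induced[OF G, of X]
        by (intro orientable_contract[OF G less.prems(4) _ x] IH)
          (auto simp: induced_def contract_def)
    next
      case True
      let ?Y = "uverts G - {x}"
      have cut: "edge_cut G {x} = edge_cut G S" and xV: "x \<in> uverts G"
        using True XV by auto
      have Y: "?Y \<subset> uverts G" "?Y \<noteq> {}" using XV(1) True by auto
      have cardY: "card ?Y < card (uverts G)" using Y finite_uverts by (simp add: psubset_card_mono)
      show ?thesis
      proof (cases "\<forall>i<3. spans (induced G ?Y) (T i)")
        case True
        have "2 \<le> card (edge_cut G {x})" using cut sum pos[of 0] pos[of 1] pos[of 2] by simp
        then show ?thesis
          using Y cardY True fin_multigraph_induced[OF G, of ?Y]
          by (intro orientable_delete_vertex[OF G less.prems(4) xV] IH) (auto simp: induced_def)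
      next
        case False
        have "?Y = S \<or> ?Y = uverts G - S" using X(1) \<open>X = {x}\<close> S by auto
        then have spY: "spans (induced G ?Y) (T i)" if "i < 3" "i \<noteq> j" for i
          using side that by blast
        then have nj: "\<not> spans (induced G ?Y) (T j)" using False by blast
        have cutY: "edge_cut G ?Y = edge_cut G {x}" by (rule edge_cut_complement[OF G])
        have spj: "spans G (T j)" using less.prems(3) j(1) by blast
        have "card (edge_cut G ?Y \<inter> T j) \<le> 2" using le2 j(1) cut cutY by simp
        \<comment> \<open>Since \<open>T j\<close> fails to span \<open>?Y\<close>, it has exactly
          two edges at \<open>x\<close>, and these lead to different pieces \<open>R\<close> and
          \<open>?Y - R\<close>. Hence \<open>a\<close> and \<open>b\<close> are distinct and the
          lifted edge is no loop.\<close>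
        from not_spans_induced_pairE[OF G spj Y(1) nj this] obtain R e f where
          R: "R \<subset> ?Y" "e \<noteq> f" "edge_cut G {x} \<inter> T j = {e, f}"
            "edge_cut G R \<inter> T j = {e}" "edge_cut G (?Y - R) \<inter> T j = {f}"
          unfolding cutY by metis
        have ends_x: "\<exists>a \<in> Z. ends G g = {x, a}"
          if "g \<in> edge_cut G {x}" "g \<in> edge_cut G Z" "Z \<subseteq> ?Y" for g Z
        proof -
          have "g \<in> uedges G" using that by (auto simp: edge_cut_def)
          with ends_pair[OF G] obtain c d where "ends G g = {c, d}" by metis
          then show ?thesis using that by (auto simp: edge_cut_def)
        qed
        obtain a where a: "a \<in> R" "ends G e = {x, a}" using ends_x[of e R] R by blast
        obtain b where b: "b \<in> ?Y - R" "ends G f = {x, b}" using ends_x[of f "?Y - R"] R by blast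
        have ab: "{a, b} \<subseteq> ?Y" "a \<noteq> b" using a b R(1) by auto
        \<comment> \<open>Two edges of \<open>T j\<close> and at least one from each of the other
          two sets give degree at least four.\<close>
        have "?c j = 2" using R(2,3) cut by simp
        then have deg: "4 \<le> card (edge_cut G {x})"
          using sum cut pos[of 0] pos[of 1] pos[of 2] j(1) by (auto simp: lt3)
        let ?H = "split_off G x e a b"
        have "spans ?H (T i)" if "i < 3" for i
        proof (cases "i = j")
          case True
          then show ?thesis using spans_split_off[OF G spj xV R(3) a(2) b(2) ab(1)] by simp
        next
          case False
          then show ?thesis
            using spans_split_off_if_spans_induced[OF spY[OF that]] a(2) by blast
        qed
        then show ?thesis
          using Y cardY fin_multigraph_split_off[OF G ab(2,1)] R(2,3) a b ab
          by (intro orientable_split_off[OF G less.prems(4) xV _ _ R(2) a(2) b(2) _ _ ab(2) deg] IH)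
            (auto simp: split_off_def)
      qed
    qed
  qed
qed

theorem theorem3:
  fixes G :: "('v, 'e) ugraph" and p :: "'v \<Rightarrow> 3"
  assumes "JLPT_conjecture"
    and "fin_multigraph G"
    and "p_balanced G p"
    and "tree_connected 3 G"
  shows "\<exists>D. is_p_orientation G p D"
proof -
  obtain T :: "nat \<Rightarrow> 'e set" where T: "\<forall>i<3. is_spanning_tree G (T i)" "disjoint_family_on T {..<3}"
    using assms(4) unfolding tree_connected_def by blast
  then have "\<forall>i<3. ugraph_connected (restrict_edges G (T i)) \<and> T i \<subseteq> uedges G"
    by (simp add: is_spanning_tree_def is_tree_def)
  then have "\<forall>i<3. spans G (T i)" "uverts G \<noteq> {}"
    using ugraph_connected_imp_spans by (blast, force simp: ugraph_connected_def restrict_edges_def)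
  then show ?thesis
    using orientable_if_three_disjoint_spanning[OF assms(1) T(2) assms(2)] assms(3)
      orientable_iff_p_orientation[OF assms(2)] by blast
qed

end
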